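(* For a real number $\lambda\ge 0$ define $$S_\lambda=\sum_{n\ge 0}\frac{[n^\lambda]}{n!}.$$ Then the set $\{1,e\}\cup\{S_\lambda:\lambda\in(0,\infty)\setminus\mathbb{Z}\}$ is linearly independent over $\mathbb{Q}$; that is, the real numbers $1$, $e$, and $S_\lambda$ (with $\lambda$ ranging over all positive non-integral real numbers, distinct $\lambda$ giving distinct members of the family) are $\mathbb{Q}$-linearly independent.
   Context: $[x]$ denotes the integer part (floor) of the real number $x$, and $e=\sum_{n\ge0}1/n!$. Only values $S_\lambda$ with $\lambda>0$ enter the conclusion, and for these $0^\lambda=0$, so the $n=0$ term is $0$. *)

theory Defs
  imports Complex_Main
begin

interpretation rat_real: vector_space "\<lambda>(q::rat) (x::real). of_rat q * x"
  by unfold_locales (auto simp: algebra_simps of_rat_add of_rat_mult)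

text \<open>
  For \<open>l > 0\<close> the term at \<open>n = 0\<close> is \<open>0\<close>. At \<open>l = 0\<close> the library convention
  \<open>0 powr 0 = 0\<close> also makes it \<open>0\<close>, where reading \<open>0^0\<close> as \<open>1\<close> would give \<open>1\<close>.
\<close>

definition S :: "real \<Rightarrow> real"
  where "S l = (\<Sum>n. of_int \<lfloor>real n powr l\<rfloor> / fact n)"

lemma summable_pow_over_fact: "summable (\<lambda>n. real n ^ k / fact n)"
proof (induction k rule: less_induct)
  case (less k)
  show ?case
  proof (cases k)
    case 0
    then show ?thesis using summable_exp[of "1::real"] by (simp add: field_simps)
  next
    case (Suc j)
    have "real (Suc n) ^ k / fact (Suc n) = (\<Sum>i\<le>j. real (j choose i) * (real n ^ i / fact n))" for n
    proof -
      have "real (Suc n) ^ k / fact (Suc n) = (real n + 1) ^ j / fact n"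
        by (simp add: Suc divide_simps del: of_nat_Suc) (simp add: algebra_simps)
      then show ?thesis
        by (simp add: binomial_ring sum_divide_distrib)
    qed
    moreover have "summable (\<lambda>n. \<Sum>i\<le>j. real (j choose i) * (real n ^ i / fact n))"
      by (intro summable_sum summable_mult less) (simp add: Suc)
    ultimately have "summable (\<lambda>n. real (Suc n) ^ k / fact (Suc n))" by simp
    then show ?thesis by (simp only: summable_Suc_iff[of "\<lambda>n. real n ^ k / fact n"])
  qed
qed

lemma summable_S: "summable (\<lambda>n. of_int \<lfloor>real n powr l\<rfloor> / fact n :: real)"
proof (rule summable_comparison_test'[where N = 1])
  show "summable (\<lambda>n. real n ^ nat \<lceil>l\<rceil> / fact n)" by (rule summable_pow_over_fact)
next
  fix n :: nat assume n: "1 \<le> n"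
  have "real n powr l \<le> real n powr real (nat \<lceil>l\<rceil>)"
    using n by (intro powr_mono) linarith+
  also have "\<dots> = real n ^ nat \<lceil>l\<rceil>" using n by (simp add: powr_realpow)
  finally have "of_int \<lfloor>real n powr l\<rfloor> \<le> real n ^ nat \<lceil>l\<rceil>"
    by linarith
  then show "norm (of_int \<lfloor>real n powr l\<rfloor> / fact n :: real) \<le> real n ^ nat \<lceil>l\<rceil> / fact n"
    by (simp add: divide_right_mono)
qed

end

theory Submission
  imports Defs "HOL-Computational_Algebra.Polynomial" "HOL-Analysis.Generalised_Binomial_Theorem"
    "HOL-Real_Asymp.Real_Asymp"
begin

text \<open>
  Clear denominators in a relation \<open>a\<^sub>0 + a\<^sub>1 e + (\<Sum>\<^sub>l c\<^sub>l S\<^sub>l) = 0\<close> and put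
  \<open>f n = a\<^sub>1 + (\<Sum>\<^sub>l c\<^sub>l \<lfloor>n\<^sup>l\<rfloor>)\<close>. The scaled tails \<open>r N = N! (\<Sum>n>N. f n / n!)\<close> are integers and
  satisfy \<open>(N + 1) r N - r (N + 1) = f (N + 1)\<close>. Up to a bounded error \<open>f\<close> is a finite sum of real
  powers; solving the recurrence asymptotically shows that \<open>r\<close> is such a sum up to \<open>o(1)\<close>. Hence a
  sufficiently high difference of \<open>r\<close> tends to \<open>0\<close>, and being integral it vanishes eventually.
  So \<open>r\<close>, and with it \<open>f\<close>, is eventually a polynomial, whereas \<open>f n\<close> is asymptotic to
  \<open>c\<^sub>m n\<^sup>m\<close> with \<open>m\<close> non-integral the largest exponent such that \<open>c\<^sub>m \<noteq> 0\<close>. If all \<open>c\<^sub>l\<close>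
  vanish, \<open>r\<close> itself tends to \<open>0\<close>, which forces \<open>a\<^sub>1 = 0\<close>.
\<close>

section \<open>Differences of sums of real powers\<close>

definition fwd :: "(nat \<Rightarrow> 'a::minus) \<Rightarrow> nat \<Rightarrow> 'a"
  where "fwd u n = u (Suc n) - u n"

lemma fwd_add: "fwd (\<lambda>n. u n + v n) n = fwd u n + fwd v n" for u v :: "nat \<Rightarrow> real"
  by (simp add: fwd_def)

text \<open>Finite sums of powers with real exponents at most \<open>k\<close>, up to \<open>o(1)\<close>.\<close>

inductive power_sum :: "real \<Rightarrow> (nat \<Rightarrow> real) \<Rightarrow> bool" for k where
  null: "u \<longlonglongrightarrow> 0 \<Longrightarrow> power_sum k u"
| powr: "m \<le> k \<Longrightarrow> power_sum k (\<lambda>n. c * real n powr m)"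
| add: "power_sum k u \<Longrightarrow> power_sum k v \<Longrightarrow> power_sum k (\<lambda>n. u n + v n)"

lemma power_sum_mono: "power_sum k u \<Longrightarrow> k \<le> l \<Longrightarrow> power_sum l u"
  by (induction rule: power_sum.induct) (auto intro: power_sum.intros)

lemma power_sum_sum:
  "finite I \<Longrightarrow> (\<And>i. i \<in> I \<Longrightarrow> power_sum k (u i)) \<Longrightarrow> power_sum k (\<lambda>n. \<Sum>i\<in>I. u i n)"
  by (induction rule: finite_induct) (auto intro: power_sum.intros)

text \<open>Every admissible power now has a negative exponent. This is where repeated differences
  end up.\<close>

lemma power_sum_neg:
  assumes "power_sum k u" "k < 0"
  shows "u \<longlonglongrightarrow> 0"
  using assms
proof (induction rule: power_sum.induct)
  case (powr m c)
  then have "(\<lambda>n. real n powr m) \<longlonglongrightarrow> 0"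
    by (intro tendsto_neg_powr filterlim_real_sequentially) auto
  then show ?case by (rule tendsto_mult_right_zero)
next
  case (add u v)
  then show ?case using tendsto_add[of u 0 sequentially v 0] by simp
qed

text \<open>Dividing by n^m turns this into the binomial series of (1 + z)^m at z = 1/n, cut after J
  terms. The remainder is z^J times a function with a finite limit at 0, so the whole is O(n^(m -
  J)) with m - J < 0.\<close>

lemma binomial_remainder_tendsto_0:
  fixes m :: real
  assumes "m < real J"
  shows "(\<lambda>n. real (Suc n) powr m - (\<Sum>j<J. (m gchoose j) * real n powr (m - real j))) \<longlonglongrightarrow> 0"
proof -
  \<comment> \<open>\<open>R\<close> is the series left over after removing J terms and dividing by
    z^J; its value at 0 is the constant coefficient of that series.\<close>
  define R where "R z = (if z = 0 then m gchoose J else ((1 + z) powr m - (\<Sum>j<J. (m gchoose j) * z ^ j)) / z ^ J)" for z :: real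
  have "(\<lambda>n. (m gchoose (n + J)) * z ^ n) sums R z" if "z \<noteq> 0" "norm z < 1" for z
  proof -
    have "(\<lambda>n. (m gchoose n) * z ^ n) sums (1 + z) powr m"
      using that by (intro gen_binomial_real) auto
    then have "(\<lambda>n. (m gchoose (n + J)) * z ^ (n + J)) sums ((1 + z) powr m - (\<Sum>j<J. (m gchoose j) * z ^ j))"
      by (rule sums_split_initial_segment)
    from sums_divide[OF this, of "z ^ J"] that show ?thesis
      by (simp add: R_def power_add)
  qed
  then have "(R \<longlongrightarrow> (m gchoose (0 + J))) (at 0)"
    by (intro powser_limit_0_strong[of 1 "\<lambda>n. m gchoose (n + J)"]) auto
  moreover have "filterlim (\<lambda>n. 1 / real n) (at 0) sequentially" by real_asymp
  ultimately have "(\<lambda>n. R (1 / real n)) \<longlonglongrightarrow> (m gchoose (0 + J))"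
    by (rule filterlim_compose)
  moreover have "(\<lambda>n. real n powr (m - real J)) \<longlonglongrightarrow> 0"
    using assms by (intro tendsto_neg_powr filterlim_real_sequentially) auto
  ultimately have "(\<lambda>n. real n powr (m - real J) * R (1 / real n)) \<longlonglongrightarrow> 0"
    by (auto dest: tendsto_mult)
  moreover have "\<forall>\<^sub>F n in sequentially. real n powr (m - real J) * R (1 / real n) =
      real (Suc n) powr m - (\<Sum>j<J. (m gchoose j) * real n powr (m - real j))"
    using eventually_gt_at_top[of 0]
  proof eventually_elim
    case (elim n)
    have powr: "real n powr (m - real j) = real n powr m * (1 / real n) ^ j" for j
      using elim by (simp add: powr_diff powr_realpow divide_simps)
    have "real (Suc n) powr m = (real n * (1 + 1 / real n)) powr m"
      using elim by (simp add: algebra_simps)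
    also have "\<dots> = real n powr m * (1 + 1 / real n) powr m"
      using elim by (subst powr_mult) auto
    finally have "real (Suc n) powr m = real n powr m * (1 + 1 / real n) powr m" .
    moreover have "real n powr (m - real J) * R (1 / real n) =
        real n powr m * ((1 + 1 / real n) powr m - (\<Sum>j<J. (m gchoose j) * (1 / real n) ^ j))"
      unfolding powr R_def using elim by simp
    ultimately show ?case
      by (simp add: powr right_diff_distrib sum_distrib_left mult_ac)
  qed
  ultimately show ?thesis by (rule Lim_transform_eventually)
qed

text \<open>In the expansion of (n + 1)^m the j = 0 term cancels against n^m, and the other
  exponents m - j are at most k - 1. The cutoff is written \<open>Suc J\<close> so that there is a j
  = 0 term to split off.\<close>

lemma power_sum_fwd_powr:
  assumes "m \<le> k"
  shows "power_sum (k - 1) (fwd (\<lambda>n. c * real n powr m))"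
proof -
  obtain J where J: "m < real (Suc J)"
    using reals_Archimedean2[of m] by (metis less_Suc_eq less_trans of_nat_less_iff)
  let ?r = "\<lambda>n. real (Suc n) powr m - (\<Sum>j<Suc J. (m gchoose j) * real n powr (m - real j))"
  have "power_sum (k - 1) (\<lambda>n. c * ?r n + (\<Sum>j<J. (c * (m gchoose Suc j)) * real n powr (m - real (Suc j))))"
    using assms by (intro power_sum.add power_sum_sum power_sum.powr power_sum.null
      tendsto_mult_right_zero binomial_remainder_tendsto_0 J) auto
  also have "(\<lambda>n. c * ?r n + (\<Sum>j<J. (c * (m gchoose Suc j)) * real n powr (m - real (Suc j)))) =
      fwd (\<lambda>n. c * real n powr m)"
    by (rule ext, subst sum.lessThan_Suc_shift)
       (simp add: fwd_def algebra_simps sum_distrib_left)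
  finally show ?thesis .
qed

lemma power_sum_fwd: "power_sum k u \<Longrightarrow> power_sum (k - 1) (fwd u)"
proof (induction rule: power_sum.induct)
  case (null u)
  then have "(\<lambda>n. u (Suc n) - u n) \<longlonglongrightarrow> 0 - 0"
    by (intro tendsto_diff LIMSEQ_Suc)
  then show ?case by (intro power_sum.null) (simp add: fwd_def[abs_def])
next
  case (powr m c)
  then show ?case by (rule power_sum_fwd_powr)
next
  case (add u v)
  then show ?case
    using power_sum.add[of "k - 1" "fwd u" "fwd v"] by (simp add: fwd_add[abs_def, symmetric])
qed

lemma power_sum_funpow_fwd: "power_sum k u \<Longrightarrow> power_sum (k - real p) ((fwd ^^ p) u)"
proof (induction p)
  case (Suc p)
  then show ?case using power_sum_fwd[of "k - real p" "(fwd ^^ p) u"] by (simp add: algebra_simps)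
qed simp

text \<open>The recurrence produces f at N + 1, so the class must be stable under shifts. A shift
  only adds the difference, which has lower order.\<close>

lemma power_sum_shift:
  assumes "power_sum k u"
  shows "power_sum k (\<lambda>n. u (Suc n))"
proof -
  have "power_sum k (\<lambda>n. u n + fwd u n)"
    using assms power_sum_fwd[OF assms] by (intro power_sum.add) (auto elim: power_sum_mono)
  then show ?thesis by (simp add: fwd_def)
qed

section \<open>The recurrence for scaled tails of a factorial series\<close>

lemma Bseq_add_seq:
  fixes u v :: "nat \<Rightarrow> 'a::real_normed_vector"
  assumes "Bseq u" "Bseq v"
  shows "Bseq (\<lambda>n. u n + v n)"
proof -
  obtain K L where "\<And>n. norm (u n) \<le> K" "\<And>n. norm (v n) \<le> L"
    using assms by (meson BseqE)
  then have "norm (u n + v n) \<le> K + L" for n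
    by (rule norm_triangle_mono)
  then show ?thesis by (rule BseqI')
qed

text \<open>Divided by (n + 1)!, this is the telescoping difference r n / n! - r (n + 1) / (n +
  1)!.\<close>

definition fact_step :: "(nat \<Rightarrow> real) \<Rightarrow> nat \<Rightarrow> real"
  where "fact_step r n = real (Suc n) * r n - r (Suc n)"

lemma fact_step_add: "fact_step (\<lambda>n. u n + v n) n = fact_step u n + fact_step v n"
  by (simp add: fact_step_def algebra_simps)

lemma fact_step_diff: "fact_step (\<lambda>n. u n - v n) n = fact_step u n - fact_step v n"
  by (simp add: fact_step_def algebra_simps)

text \<open>
  For \<open>n\<^sup>m\<close> the first approximation is \<open>n\<^bsup>m-1\<^esup>\<close>; its residual is a difference of \<open>n\<^bsup>m-1\<^esup>\<close>,
  hence of lower order, and one can iterate until the residual tends to \<open>0\<close>.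
\<close>

lemma ex_fact_step_approx:
  assumes "power_sum k u"
  shows "\<exists>h. power_sum k h \<and> Bseq (\<lambda>n. fact_step h n - u n)"
proof -
  obtain p :: nat where "k < real p" using reals_Archimedean2 by blast
  then show ?thesis using assms
  \<comment> \<open>The outer induction is on an integer above the exponent bound, the inner one on
    the build-up of the sum. Only the case of a single power uses the outer hypothesis.\<close>
  proof (induction p arbitrary: k u)
    case 0
    then have "u \<longlonglongrightarrow> 0" by (auto intro: power_sum_neg)
    then have "Bseq (\<lambda>n. fact_step (\<lambda>_. 0) n - u n)"
      by (simp add: fact_step_def convergent_imp_Bseq convergentI Bseq_minus_iff)
    then show ?case by (blast intro: power_sum.null tendsto_const)
  next
    case (Suc p)
    from Suc.prems(2) show ?case
    proof (induction rule: power_sum.induct)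
      case (null u)
      then have "Bseq (\<lambda>n. fact_step (\<lambda>_. 0) n - u n)"
        by (simp add: fact_step_def convergent_imp_Bseq convergentI Bseq_minus_iff)
      then show ?case by (blast intro: power_sum.null tendsto_const)
    next
      case (powr m c)
      define h0 where "h0 = (\<lambda>n. c * real n powr (m - 1))"
      have "power_sum (k - 1) (fwd h0)"
        unfolding h0_def using powr by (intro power_sum_fwd_powr) simp
      with Suc.IH[of "k - 1"] Suc.prems(1) obtain h
        where h: "power_sum (k - 1) h" "Bseq (\<lambda>n. fact_step h n - fwd h0 n)" by auto
      \<comment> \<open>Since (n + 1) n^(m-1) = n^m + n^(m-1), \<open>h0\<close> alone leaves the
        residual \<open>- fwd h0\<close>, which \<open>h\<close> cancels up to a bounded error. At n
        = 0 both powers are 0 by the convention for \<open>powr\<close>.\<close>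
      have "fact_step (\<lambda>n. h0 n + h n) n - c * real n powr m = fact_step h n - fwd h0 n" for n
        by (cases "n = 0") (simp_all add: fact_step_def fwd_def h0_def algebra_simps powr_diff add_divide_distrib)
      moreover have "power_sum k (\<lambda>n. h0 n + h n)"
        using powr h(1) unfolding h0_def by (intro power_sum.add power_sum.powr) (auto intro: power_sum_mono)
      ultimately show ?case using h(2) by (intro exI[of _ "\<lambda>n. h0 n + h n"]) simp
    next
      case (add u v)
      then obtain h g where h: "power_sum k h" "Bseq (\<lambda>n. fact_step h n - u n)"
        and g: "power_sum k g" "Bseq (\<lambda>n. fact_step g n - v n)" by blast
      have "fact_step (\<lambda>n. h n + g n) n - (u n + v n) = (fact_step h n - u n) + (fact_step g n - v n)" for n
        by (simp add: fact_step_add)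
      then have "Bseq (\<lambda>n. fact_step (\<lambda>n. h n + g n) n - (u n + v n))"
        using Bseq_add_seq[OF h(2) g(2)] by (simp only:)
      with power_sum.add[OF h(1) g(1)] show ?case by blast
    qed
  qed
qed

section \<open>Growth relative to the factorial\<close>

lemma powr_over_fact_tendsto_0: "(\<lambda>n. real n powr m / fact n) \<longlonglongrightarrow> 0"
proof (rule tendsto_sandwich[of "\<lambda>_. 0" _ _ "\<lambda>n. real n ^ nat \<lceil>m\<rceil> / fact n"])
  have "real n powr m \<le> real n ^ nat \<lceil>m\<rceil>" if "n \<ge> 1" for n
  proof -
    have "real n powr m \<le> real n powr real (nat \<lceil>m\<rceil>)"
      using that by (intro powr_mono) linarith+
    then show ?thesis using that by (simp add: powr_realpow)
  qed
  then show "\<forall>\<^sub>F n in sequentially. real n powr m / fact n \<le> real n ^ nat \<lceil>m\<rceil> / fact n"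
    by (auto simp: eventually_sequentially intro!: exI[of _ 1] divide_right_mono)
  show "(\<lambda>n. real n ^ nat \<lceil>m\<rceil> / fact n) \<longlonglongrightarrow> 0"
    by (rule summable_LIMSEQ_zero[OF summable_pow_over_fact])
  show "\<forall>\<^sub>F n in sequentially. 0 \<le> real n powr m / fact n" by simp
qed simp

lemma power_sum_over_fact_tendsto_0: "power_sum k u \<Longrightarrow> (\<lambda>n. u n / fact n) \<longlonglongrightarrow> 0"
proof (induction rule: power_sum.induct)
  case (null u)
  have "(\<lambda>n. 1 / fact n :: real) \<longlonglongrightarrow> 0"
    using summable_LIMSEQ_zero[OF summable_pow_over_fact[of 0]] by simp
  from tendsto_mult[OF null this] show ?case by simp
next
  case (powr m c)
  then show ?case using tendsto_mult_right_zero[OF powr_over_fact_tendsto_0[of m], of c] by simp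
next
  case (add u v)
  then show ?case using tendsto_add[OF add.IH] by (simp add: add_divide_distrib)
qed

text \<open>The homogeneous solutions are the multiples of n!, and the decay condition excludes
  them. Telescoping r n / n! then recovers r N as N! times a tail of the series of
  \<open>fact_step r n\<close> / (n + 1)!, which is O(1 / (N + 1)) for bounded numerators.\<close>

lemma fact_step_Bseq_imp_tendsto_0:
  assumes "Bseq (fact_step r)" and lim: "(\<lambda>n. r n / fact n) \<longlonglongrightarrow> 0"
  shows "r \<longlonglongrightarrow> 0"
proof -
  obtain B where B: "\<And>n. \<bar>fact_step r n\<bar> \<le> B" "B > 0"
    using assms(1) by (auto simp: Bseq_def)
  have tele: "(\<lambda>n. fact_step r (n + N) / fact (Suc (n + N))) sums (r N / fact N)" for N
  proof -
    have "(\<lambda>n. r (n + N) / fact (n + N)) \<longlonglongrightarrow> 0"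
      using lim by (rule LIMSEQ_ignore_initial_segment)
    from telescope_sums'[OF this]
    have "(\<lambda>n. r (n + N) / fact (n + N) - r (Suc n + N) / fact (Suc n + N)) sums (r N / fact N)" by simp
    moreover have "r (n + N) / fact (n + N) - r (Suc n + N) / fact (Suc n + N) = fact_step r (n + N) / fact (Suc (n + N))" for n
      using fact_Suc[of "n + N", where 'a = real]
      by (simp add: fact_step_def diff_divide_distrib del: fact_Suc of_nat_Suc)
    ultimately show ?thesis by simp
  qed
  have e: "(\<lambda>n. 1 / fact n :: real) sums exp 1"
    using exp_converges[of "1::real"] by (simp add: field_simps)
  have bound: "\<bar>r N\<bar> \<le> B * exp 1 / real (Suc N)" for N
  proof -
    \<comment> \<open>Because n! (N + 1)! divides (n + N + 1)!, the tail is dominated by the series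
      for e divided by (N + 1)!.\<close>
    have le: "norm (fact_step r (n + N) / fact (Suc (n + N))) \<le> B / fact (Suc N) * (1 / fact n)" for n
    proof -
      have "fact n * fact (Suc N) dvd (fact (n + Suc N) :: nat)" by (rule fact_fact_dvd_fact)
      then have "fact n * fact (Suc N) \<le> (fact (n + Suc N) :: nat)" by (rule dvd_imp_le) simp
      then have "real (fact n * fact (Suc N)) \<le> real (fact (n + Suc N))"
        by (simp only: of_nat_le_iff)
      then have "fact n * fact (Suc N) \<le> (fact (Suc (n + N)) :: real)"
        by (simp only: of_nat_mult of_nat_fact add_Suc_right)
      then have "\<bar>fact_step r (n + N)\<bar> / fact (Suc (n + N)) \<le> B / (fact n * fact (Suc N))"
        using B by (intro frac_le) auto
      then show ?thesis by (simp add: mult_ac)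
    qed
    have S: "(\<lambda>n. B / fact (Suc N) * (1 / fact n)) sums (B / fact (Suc N) * exp 1)"
      by (rule sums_mult[OF e])
    have "norm (\<Sum>n. fact_step r (n + N) / fact (Suc (n + N))) \<le> (\<Sum>n. B / fact (Suc N) * (1 / fact n))"
      using le sums_summable[OF S] by (rule norm_suminf_le)
    then have "\<bar>r N\<bar> / fact N \<le> B / fact (Suc N) * exp 1"
      using sums_unique[OF tele[of N]] sums_unique[OF S] by simp
    also have "\<dots> = B * exp 1 / real (Suc N) / fact N"
      by (simp add: mult_ac)
    finally show ?thesis by (simp only: divide_le_cancel) (simp add: not_less del: of_nat_Suc)
  qed
  have "(\<lambda>N. B * exp 1 / real (Suc N)) \<longlonglongrightarrow> 0" by real_asymp
  then show ?thesis by (rule Lim_null_comparison[rotated]) (use bound in auto)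
qed


section \<open>Eventually polynomial sequences\<close>

definition eventually_poly :: "(nat \<Rightarrow> real) \<Rightarrow> bool"
  where "eventually_poly u \<longleftrightarrow> (\<exists>q. \<forall>\<^sub>F n in sequentially. u n = poly q (real n))"

lemma eventually_poly_const: "eventually_poly (\<lambda>_. c)"
  unfolding eventually_poly_def by (intro exI[of _ "[:c:]"]) simp

lemma eventually_poly_id: "eventually_poly real"
  unfolding eventually_poly_def by (intro exI[of _ "[:0, 1:]"]) simp

lemma eventually_poly_add:
  assumes "eventually_poly u" "eventually_poly v"
  shows "eventually_poly (\<lambda>n. u n + v n)"
proof -
  obtain p q where "\<forall>\<^sub>F n in sequentially. u n = poly p (real n)" "\<forall>\<^sub>F n in sequentially. v n = poly q (real n)"
    using assms unfolding eventually_poly_def by blast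
  then have "\<forall>\<^sub>F n in sequentially. u n + v n = poly (p + q) (real n)"
    by eventually_elim simp
  then show ?thesis unfolding eventually_poly_def by blast
qed

lemma eventually_poly_mult:
  assumes "eventually_poly u" "eventually_poly v"
  shows "eventually_poly (\<lambda>n. u n * v n)"
proof -
  obtain p q where "\<forall>\<^sub>F n in sequentially. u n = poly p (real n)" "\<forall>\<^sub>F n in sequentially. v n = poly q (real n)"
    using assms unfolding eventually_poly_def by blast
  then have "\<forall>\<^sub>F n in sequentially. u n * v n = poly (p * q) (real n)"
    by eventually_elim simp
  then show ?thesis unfolding eventually_poly_def by blast
qed

lemma eventually_poly_sum:
  "finite I \<Longrightarrow> (\<And>i. i \<in> I \<Longrightarrow> eventually_poly (u i)) \<Longrightarrow> eventually_poly (\<lambda>n. \<Sum>i\<in>I. u i n)"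
  by (induction rule: finite_induct) (auto intro: eventually_poly_const eventually_poly_add)

lemma eventually_poly_cong:
  assumes "\<forall>\<^sub>F n in sequentially. u n = v n" "eventually_poly v"
  shows "eventually_poly u"
proof -
  obtain q where "\<forall>\<^sub>F n in sequentially. v n = poly q (real n)"
    using assms(2) unfolding eventually_poly_def by blast
  with assms(1) have "\<forall>\<^sub>F n in sequentially. u n = poly q (real n)"
    by eventually_elim simp
  then show ?thesis unfolding eventually_poly_def by blast
qed

lemma eventually_poly_binomial: "eventually_poly (\<lambda>n. real (n choose i))"
proof (induction i)
  case (Suc i)
  have "real (n choose Suc i) = real (n choose i) * ((real n + (- real i)) * (1 / real (Suc i)))" for n
    using gbinomial_mult_1[of "real n" i]
    by (simp add: binomial_gbinomial field_simps)
  moreover have "eventually_poly (\<lambda>n. real (n choose i) * ((real n + (- real i)) * (1 / real (Suc i))))"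
    using Suc by (intro eventually_poly_mult eventually_poly_add eventually_poly_const eventually_poly_id)
  ultimately show ?case by (simp only:)
qed (simp add: eventually_poly_const)

text \<open>Polynomiality is first obtained for f at n + 1; substituting x - 1 for x in the
  polynomial carries it back to f.\<close>

lemma eventually_poly_shift:
  assumes "eventually_poly (\<lambda>n. u (Suc n))"
  shows "eventually_poly u"
proof -
  obtain q where "\<forall>\<^sub>F n in sequentially. u (Suc n) = poly q (real n)"
    using assms unfolding eventually_poly_def by blast
  then have "\<forall>\<^sub>F n in sequentially. u (Suc n) = poly (q \<circ>\<^sub>p [:-1, 1:]) (real (Suc n))"
    by eventually_elim (simp add: poly_pcompose)
  then show ?thesis
    unfolding eventually_poly_def by (subst (asm) eventually_sequentially_Suc) blast
qed

lemma eventually_poly_Suc: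
  assumes "eventually_poly u"
  shows "eventually_poly (\<lambda>n. u (Suc n))"
proof -
  obtain q where "\<forall>\<^sub>F n in sequentially. u n = poly q (real n)"
    using assms unfolding eventually_poly_def by blast
  then have "\<forall>\<^sub>F n in sequentially. u (Suc n) = poly q (real (Suc n))"
    by (subst eventually_sequentially_Suc)
  then have "\<forall>\<^sub>F n in sequentially. u (Suc n) = poly (q \<circ>\<^sub>p [:1, 1:]) (real n)"
    by eventually_elim (simp add: poly_pcompose)
  then show ?thesis
    unfolding eventually_poly_def by blast
qed

section \<open>Integer sequences and vanishing higher differences\<close>

lemma funpow_fwd_eq_0_imp_newton:
  fixes u :: "nat \<Rightarrow> real"
  assumes "\<And>n. n \<ge> N \<Longrightarrow> (fwd ^^ p) u n = 0"
  shows "\<exists>a. \<forall>n\<ge>N. u n = (\<Sum>i<p. a i * real (n choose i))"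
  using assms
proof (induction p arbitrary: u)
  case (Suc p)
  then have "(fwd ^^ p) (fwd u) n = 0" if "n \<ge> N" for n
    using that by (simp add: funpow_swap1)
  from Suc.IH[OF this] obtain a where a: "\<And>n. n \<ge> N \<Longrightarrow> fwd u n = (\<Sum>i<p. a i * real (n choose i))"
    by blast
  \<comment> \<open>By Pascal's rule the difference of \<open>n choose Suc i\<close> is
    \<open>n choose i\<close>, so \<open>w\<close> is an antidifference of \<open>fwd u\<close> and
    u - w is constant from N on.\<close>
  define w where "w = (\<lambda>n. \<Sum>i<p. a i * real (n choose Suc i))"
  have "u n - w n = u N - w N" if "n \<ge> N" for n
    using that
  proof (induction n rule: dec_induct)
    case (step n)
    have "w (Suc n) - w n = fwd u n"
      using a[OF step(1)] by (simp add: w_def sum_subtractf[symmetric] algebra_simps)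
    then show ?case using step by (simp add: fwd_def)
  qed simp
  then have "u n = (\<Sum>i<Suc p. (case i of 0 \<Rightarrow> u N - w N | Suc j \<Rightarrow> a j) * real (n choose i))" if "n \<ge> N" for n
    using that by (subst sum.lessThan_Suc_shift) (simp add: w_def algebra_simps)
  then show ?case by (intro exI[of _ "case_nat (u N - w N) a"]) blast
qed simp

lemma funpow_fwd_in_Ints: "(\<And>n. u n \<in> \<int>) \<Longrightarrow> (fwd ^^ p) u n \<in> \<int>" for u :: "nat \<Rightarrow> real"
  by (induction p arbitrary: n) (auto simp: fwd_def)

lemma Ints_tendsto_0_eventually_0:
  fixes u :: "nat \<Rightarrow> real"
  assumes "\<And>n. u n \<in> \<int>" "u \<longlonglongrightarrow> 0"
  shows "\<forall>\<^sub>F n in sequentially. u n = 0"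
proof -
  have "\<forall>\<^sub>F n in sequentially. dist (u n) 0 < 1"
    using assms(2) by (rule tendstoD) simp
  then show ?thesis
    by eventually_elim (use assms(1) Ints_nonzero_abs_less1 in auto)
qed

text \<open>Each difference lowers the exponent bound by 1, so for p > k the p-th difference tends
  to 0; integrality makes it vanish eventually, and Newton's expansion applies.\<close>

lemma Ints_power_sum_eventually_poly:
  assumes "\<And>n. u n \<in> \<int>" "power_sum k u"
  shows "eventually_poly u"
proof -
  obtain p where p: "k < real p" using reals_Archimedean2 by blast
  have ints: "(fwd ^^ p) u n \<in> \<int>" for n
    using assms(1) by (intro funpow_fwd_in_Ints) auto
  from p have "(fwd ^^ p) u \<longlonglongrightarrow> 0"
    using power_sum_funpow_fwd[OF assms(2), of p] by (intro power_sum_neg) auto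
  with ints have "\<forall>\<^sub>F n in sequentially. (fwd ^^ p) u n = 0"
    by (rule Ints_tendsto_0_eventually_0)
  then obtain N where "\<And>n. n \<ge> N \<Longrightarrow> (fwd ^^ p) u n = 0"
    unfolding eventually_sequentially by blast
  then obtain a where "\<forall>n\<ge>N. u n = (\<Sum>i<p. a i * real (n choose i))"
    using funpow_fwd_eq_0_imp_newton by blast
  then show ?thesis
    by (intro eventually_poly_cong[of u "\<lambda>n. \<Sum>i<p. a i * real (n choose i)"] eventually_poly_sum
      eventually_poly_mult eventually_poly_const eventually_poly_binomial)
      (auto simp: eventually_sequentially)
qed

text \<open>Let h solve the recurrence for u up to a bounded error. Then r - h has a bounded
  right-hand side and is o(n!), hence tends to 0, so r itself is a power sum up to o(1) and
  integrality applies.\<close>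

lemma Ints_fact_step_eventually_poly:
  assumes int: "\<And>n. r n \<in> \<int>" and lim: "(\<lambda>n. r n / fact n) \<longlonglongrightarrow> 0"
    and u: "power_sum k u" "Bseq (\<lambda>n. fact_step r n - u n)"
  shows "eventually_poly (fact_step r)"
proof -
  obtain h where h: "power_sum k h" "Bseq (\<lambda>n. fact_step h n - u n)"
    using ex_fact_step_approx[OF u(1)] by blast
  have "Bseq (\<lambda>n. (fact_step r n - u n) - (fact_step h n - u n))"
    using Bseq_add_seq[OF u(2), of "\<lambda>n. - (fact_step h n - u n)"] h(2) by (simp only: Bseq_minus_iff add_uminus_conv_diff)
  then have "Bseq (fact_step (\<lambda>n. r n - h n))"
    by (simp add: fact_step_diff[abs_def])
  moreover have "(\<lambda>n. (r n - h n) / fact n) \<longlonglongrightarrow> 0"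
    using tendsto_diff[OF lim power_sum_over_fact_tendsto_0[OF h(1)]] by (simp add: diff_divide_distrib)
  ultimately have "(\<lambda>n. r n - h n) \<longlonglongrightarrow> 0"
    by (rule fact_step_Bseq_imp_tendsto_0)
  from power_sum.add[OF power_sum.null[OF this] h(1)] have "power_sum k r" by simp
  with int have r: "eventually_poly r" by (rule Ints_power_sum_eventually_poly)
  have "eventually_poly (\<lambda>n. (real n + 1) * r n + (- 1) * r (Suc n))"
    using r by (intro eventually_poly_add eventually_poly_mult eventually_poly_const eventually_poly_id eventually_poly_Suc)
  then show ?thesis by (simp add: fact_step_def[abs_def] add.commute)
qed

text \<open>Comparison with the leading term of degree d shows that n^(d - l) has a finite nonzero
  limit, which forces l = d.\<close>

lemma eventually_poly_powr_asymp:
  assumes "eventually_poly u" and lim: "(\<lambda>n. u n / real n powr l) \<longlonglongrightarrow> c" and "c \<noteq> 0"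
  shows "l \<in> \<nat>"
proof -
  obtain q where q: "\<forall>\<^sub>F n in sequentially. u n = poly q (real n)"
    using assms(1) unfolding eventually_poly_def by blast
  have "q \<noteq> 0"
  proof
    assume "q = 0"
    with q have "\<forall>\<^sub>F n in sequentially. u n / real n powr l = 0" by (simp add: eventually_mono)
    then have "(\<lambda>n. u n / real n powr l) \<longlonglongrightarrow> 0" by (rule tendsto_eventually)
    with lim \<open>c \<noteq> 0\<close> show False using LIMSEQ_unique by blast
  qed
  define d where "d = degree q"
  have "filterlim real at_infinity sequentially"
    by (rule filterlim_at_top_imp_at_infinity[OF filterlim_real_sequentially])
  then have "(\<lambda>n. poly q (real n) / real n ^ d) \<longlonglongrightarrow> lead_coeff q"
    unfolding d_def by (rule filterlim_compose[OF poly_divide_tendsto_aux])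
  from tendsto_divide[OF lim this] \<open>q \<noteq> 0\<close>
  have "(\<lambda>n. u n / real n powr l / (poly q (real n) / real n ^ d)) \<longlonglongrightarrow> c / lead_coeff q"
    by simp
  \<comment> \<open>The nonzero limit keeps u, hence the polynomial, away from 0; this justifies
    cancelling it in the quotient below.\<close>
  moreover have "\<forall>\<^sub>F n in sequentially. poly q (real n) \<noteq> 0"
  proof -
    have "\<forall>\<^sub>F n in sequentially. u n / real n powr l \<noteq> 0"
      using tendsto_imp_eventually_ne[OF lim \<open>c \<noteq> 0\<close>] .
    with q show ?thesis by eventually_elim auto
  qed
  with q eventually_gt_at_top[of 0]
  have "\<forall>\<^sub>F n in sequentially. u n / real n powr l / (poly q (real n) / real n ^ d) = real n powr (real d - l)"
    by eventually_elim (simp add: powr_diff powr_realpow)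
  ultimately have P: "(\<lambda>n. real n powr (real d - l)) \<longlonglongrightarrow> c / lead_coeff q"
    by (rule Lim_transform_eventually)
  consider "real d < l" | "real d > l" | "real d = l" by linarith
  then show ?thesis
  proof cases
    case 1
    then have "(\<lambda>n. real n powr (real d - l)) \<longlonglongrightarrow> 0"
      by (intro tendsto_neg_powr filterlim_real_sequentially) auto
    with P have "c / lead_coeff q = 0" by (rule LIMSEQ_unique)
    with \<open>c \<noteq> 0\<close> \<open>q \<noteq> 0\<close> show ?thesis by simp
  next
    case 2
    then have "filterlim (\<lambda>n. real n powr (real d - l)) at_top sequentially" by real_asymp
    then show ?thesis using P not_tendsto_and_filterlim_at_infinity[OF sequentially_bot]
      filterlim_at_top_imp_at_infinity by blast
  next
    case 3
    then show ?thesis using of_nat_in_Nats[of d, where 'a = real] by simp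
  qed
qed

section \<open>Linear relations\<close>

text \<open>The rounding error is at most 1 and disappears after division by n^m; what remains is
  n^(l - m).\<close>

lemma floor_powr_ratio_tendsto:
  assumes "0 < l" "l \<le> m"
  shows "(\<lambda>n. of_int \<lfloor>real n powr l\<rfloor> / real n powr m) \<longlonglongrightarrow> (if l = m then 1 else 0)"
proof -
  have m: "m > 0" using assms by simp
  have "(\<lambda>n. 1 / real n powr m) \<longlonglongrightarrow> 0" using m by real_asymp
  then have e: "(\<lambda>n. (of_int \<lfloor>real n powr l\<rfloor> - real n powr l) / real n powr m) \<longlonglongrightarrow> 0"
  proof (rule Lim_null_comparison[rotated])
    have "\<bar>of_int \<lfloor>real n powr l\<rfloor> - real n powr l\<bar> \<le> 1" for n by linarith
    then show "\<forall>\<^sub>F n in sequentially. norm ((of_int \<lfloor>real n powr l\<rfloor> - real n powr l) / real n powr m) \<le> 1 / real n powr m"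
      by (auto simp: divide_right_mono)
  qed
  have "(\<lambda>n. real n powr l / real n powr m) \<longlonglongrightarrow> (if l = m then 1 else 0)"
  proof (cases "l = m")
    case True
    have "(\<lambda>n. real n powr m / real n powr m) \<longlonglongrightarrow> 1"
      by (rule tendsto_eventually) (use eventually_gt_at_top[of 0] in eventually_elim, simp)
    then show ?thesis using True by simp
  next
    case False
    then have "(\<lambda>n. real n powr (l - m)) \<longlonglongrightarrow> 0"
      using assms by (intro tendsto_neg_powr filterlim_real_sequentially) auto
    then show ?thesis using False by (simp add: powr_diff)
  qed
  from tendsto_add[OF e this] show ?thesis by (simp add: diff_divide_distrib)
qed

lemma S_int_relation_trivial:
  fixes a0 a1 :: int and c :: "real \<Rightarrow> int"
  assumes fin: "finite L" and L: "\<And>l. l \<in> L \<Longrightarrow> l > 0 \<and> l \<notin> \<int>"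
    and rel: "of_int a0 + of_int a1 * exp 1 + (\<Sum>l\<in>L. of_int (c l) * S l) = 0"
  shows "a0 = 0 \<and> a1 = 0 \<and> (\<forall>l\<in>L. c l = 0)"
proof -
  define f where "f n = a1 + (\<Sum>l\<in>L. c l * \<lfloor>real n powr l\<rfloor>)" for n
  define g where "g n = (of_int (f n) / fact n :: real)" for n
  have f_real: "of_int (f n) = (of_int a1 + (\<Sum>l\<in>L. of_int (c l) * of_int \<lfloor>real n powr l\<rfloor>) :: real)" for n
    by (simp add: f_def)
  have "(\<lambda>n. of_int a1 * (1 / fact n) + (\<Sum>l\<in>L. of_int (c l) * (of_int \<lfloor>real n powr l\<rfloor> / fact n)))
     sums (of_int a1 * exp 1 + (\<Sum>l\<in>L. of_int (c l) * S l))"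
    using exp_converges[of "1::real"] summable_sums[OF summable_S]
    by (intro sums_add sums_mult sums_sum) (auto simp: S_def field_simps)
  also have "(\<lambda>n. of_int a1 * (1 / fact n) + (\<Sum>l\<in>L. of_int (c l) * (of_int \<lfloor>real n powr l\<rfloor> / fact n))) = g"
    by (rule ext) (simp add: g_def f_real add_divide_distrib sum_divide_distrib)
  also have "of_int a1 * exp 1 + (\<Sum>l\<in>L. of_int (c l) * S l) = - of_int a0"
    using rel by linarith
  finally have g: "g sums (- of_int a0)" .
  \<comment> \<open>Writing the scaled tail as total minus partial sum makes integrality visible: N!
    / n! is an integer for n up to N.\<close>
  define r where "r N = fact N * (- of_int a0 - (\<Sum>n<Suc N. g n))" for N
  have int: "r N \<in> \<int>" for N
  proof -
    have "fact N * g n \<in> \<int>" if "n < Suc N" for n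
    proof -
      have "(fact n :: int) dvd fact N" using that by (intro fact_dvd) simp
      then obtain k where "(fact N :: int) = fact n * k" by (auto elim: dvdE)
      then have "(fact N :: real) = fact n * of_int k" by (metis of_int_fact of_int_mult)
      then show ?thesis by (simp add: g_def)
    qed
    then have "(\<Sum>n<Suc N. fact N * g n) \<in> \<int>" by (intro Ints_sum) auto
    moreover have "(fact N :: real) \<in> \<int>" by (metis Ints_of_int of_int_fact)
    ultimately show ?thesis
      unfolding r_def right_diff_distrib sum_distrib_left by (intro Ints_diff Ints_mult) auto
  qed
  have step_r: "fact_step r N = of_int (f (Suc N))" for N
  proof -
    have "fact_step r N = fact (Suc N) * g (Suc N)"
      by (simp add: fact_step_def r_def algebra_simps)
    also have "\<dots> = of_int (f (Suc N))"
      by (simp add: g_def del: fact_Suc)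
    finally show ?thesis .
  qed
  have lim: "(\<lambda>N. r N / fact N) \<longlonglongrightarrow> 0"
  proof -
    have "(\<lambda>N. - of_int a0 - (\<Sum>n<Suc N. g n)) \<longlonglongrightarrow> - of_int a0 - (- of_int a0)"
      using g unfolding sums_def by (intro tendsto_diff tendsto_const LIMSEQ_Suc)
    then show ?thesis by (simp add: r_def)
  qed
  have poly: "eventually_poly (\<lambda>n. of_int (f n))"
  proof -
    obtain k where k: "\<And>l. l \<in> L \<Longrightarrow> l \<le> k"
      using fin by (meson Max_ge)
    \<comment> \<open>Dropping the floors and the constant \<open>a1\<close> changes f only by a
      bounded amount, which the recurrence lemma allows.\<close>
    define u where "u n = (\<Sum>l\<in>L. of_int (c l) * real n powr l)" for n
    have "power_sum k (\<lambda>n. u (Suc n))"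
      unfolding u_def using fin k by (intro power_sum_shift power_sum_sum power_sum.powr) auto
    moreover have "Bseq (\<lambda>n. fact_step r n - u (Suc n))"
    proof (rule BseqI')
      fix n
      have "\<bar>\<Sum>l\<in>L. of_int (c l) * (of_int \<lfloor>real (Suc n) powr l\<rfloor> - real (Suc n) powr l)\<bar> \<le> (\<Sum>l\<in>L. \<bar>of_int (c l)\<bar> * 1)"
      proof (intro order_trans[OF sum_abs] sum_mono)
        fix l
        have "\<bar>of_int \<lfloor>real (Suc n) powr l\<rfloor> - real (Suc n) powr l\<bar> \<le> 1" by linarith
        then show "\<bar>of_int (c l) * (of_int \<lfloor>real (Suc n) powr l\<rfloor> - real (Suc n) powr l)\<bar> \<le> \<bar>of_int (c l)\<bar> * 1"
          unfolding abs_mult by (rule mult_left_mono) simp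
      qed
      then show "norm (fact_step r n - u (Suc n)) \<le> \<bar>of_int a1\<bar> + (\<Sum>l\<in>L. \<bar>of_int (c l)\<bar>)"
        unfolding step_r f_real u_def by (simp add: algebra_simps sum_subtractf)
    qed
    ultimately have "eventually_poly (fact_step r)"
      by (rule Ints_fact_step_eventually_poly[OF int lim])
    then have "eventually_poly (\<lambda>n. of_int (f (Suc n)))" by (simp add: step_r[abs_def])
    then show ?thesis by (rule eventually_poly_shift)
  qed
  have c: "c l = 0" if "l \<in> L" for l
  proof (rule ccontr)
    assume "c l \<noteq> 0"
    \<comment> \<open>Only exponents with nonzero coefficient are kept, so that the largest one
      governs the growth of f.\<close>
    define L' where "L' = {l \<in> L. c l \<noteq> 0}"
    define m where "m = Max L'"
    have L': "finite L'" "L' \<noteq> {}" using fin that \<open>c l \<noteq> 0\<close> by (auto simp: L'_def)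
    then have m: "m \<in> L'" "\<And>l. l \<in> L' \<Longrightarrow> l \<le> m" by (auto simp: m_def)
    have mpos: "m > 0" "m \<notin> \<int>" "c m \<noteq> 0" using m(1) L by (auto simp: L'_def)
    have "(\<lambda>n. of_int a1 / real n powr m) \<longlonglongrightarrow> 0" using mpos(1) by real_asymp
    moreover have "(\<lambda>n. of_int (c l) * (of_int \<lfloor>real n powr l\<rfloor> / real n powr m)) \<longlonglongrightarrow> of_int (c l) * (if l = m then 1 else 0)" if "l \<in> L'" for l
      using that m(2) L by (intro tendsto_mult tendsto_const floor_powr_ratio_tendsto) (auto simp: L'_def)
    ultimately have "(\<lambda>n. of_int a1 / real n powr m + (\<Sum>l\<in>L'. of_int (c l) * (of_int \<lfloor>real n powr l\<rfloor> / real n powr m))) \<longlonglongrightarrow> 0 + (\<Sum>l\<in>L'. of_int (c l) * (if l = m then 1 else 0))"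
      by (intro tendsto_add tendsto_sum)
    moreover have "(\<Sum>l\<in>L'. of_int (c l) * (if l = m then 1 else 0)) = (of_int (c m) :: real)"
      using L'(1) m(1) by (simp add: if_distrib cong: if_cong)
    moreover have "of_int a1 / real n powr m + (\<Sum>l\<in>L'. of_int (c l) * (of_int \<lfloor>real n powr l\<rfloor> / real n powr m)) = of_int (f n) / real n powr m" for n
    proof -
      have "(\<Sum>l\<in>L. of_int (c l) * of_int \<lfloor>real n powr l\<rfloor>) = (\<Sum>l\<in>L'. of_int (c l) * of_int \<lfloor>real n powr l\<rfloor> :: real)"
        using fin by (intro sum.mono_neutral_right) (auto simp: L'_def)
      then show ?thesis by (simp add: f_real add_divide_distrib sum_divide_distrib)
    qed
    ultimately have "(\<lambda>n. of_int (f n) / real n powr m) \<longlonglongrightarrow> of_int (c m)" by simp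
    then have "m \<in> \<nat>" using mpos(3) by (intro eventually_poly_powr_asymp[OF poly]) auto
    with mpos(2) show False using Nats_subset_Ints by blast
  qed
  have f: "f n = a1" for n using c by (simp add: f_def)
  have "Bseq (fact_step r)" by (simp add: step_r[abs_def] f)
  then have "r \<longlonglongrightarrow> 0" using lim by (rule fact_step_Bseq_imp_tendsto_0)
  with int have "\<forall>\<^sub>F n in sequentially. r n = 0"
    by (rule Ints_tendsto_0_eventually_0)
  then obtain N where "\<And>n. n \<ge> N \<Longrightarrow> r n = 0" unfolding eventually_sequentially by blast
  \<comment> \<open>Two consecutive zeros of r suffice, since \<open>fact_step r N\<close> is now
    the constant \<open>a1\<close>.\<close>
  then have "fact_step r N = 0" by (simp add: fact_step_def)
  then have a1: "a1 = 0" by (simp add: step_r f)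
  with rel c show ?thesis by simp
qed

section \<open>Rational coefficients and linear independence\<close>

lemma ex_common_denominator:
  fixes q :: "'a \<Rightarrow> rat"
  assumes "finite I"
  shows "\<exists>d>0. \<exists>c. \<forall>i\<in>I. q i * of_int d = of_int (c i)"
  using assms
proof (induction rule: finite_induct)
  case empty
  show ?case by (intro exI[of _ 1]) auto
next
  case (insert x I)
  then obtain d c where d: "d > 0" "\<And>i. i \<in> I \<Longrightarrow> q i * of_int d = of_int (c i)" by blast
  obtain a b where q: "q x = Fract a b" "b > 0" by (cases "q x") auto
  have "q i * of_int (d * b) = of_int (if i = x then a * d else c i * b)" if "i \<in> insert x I" for i
    using that d(2) insert.hyps(2) q(2) q(1)
    by (auto simp: Fract_of_int_quotient mult.assoc[symmetric])
  moreover have "d * b > 0" using d(1) q(2) by simp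
  ultimately show ?case
    by (intro exI[of _ "d * b"] conjI exI[of _ "\<lambda>i. if i = x then a * d else c i * b"] ballI)
qed

lemma S_rat_relation_trivial:
  fixes a0 a1 :: rat and c :: "real \<Rightarrow> rat"
  assumes fin: "finite L" and L: "\<And>l. l \<in> L \<Longrightarrow> l > 0 \<and> l \<notin> \<int>"
    and rel: "of_rat a0 + of_rat a1 * exp 1 + (\<Sum>l\<in>L. of_rat (c l) * S l) = 0"
  shows "a0 = 0 \<and> a1 = 0 \<and> (\<forall>l\<in>L. c l = 0)"
proof -
  obtain d1 b where d1: "d1 > 0" "\<forall>i\<in>L. c i * of_int d1 = of_int (b i)"
    using ex_common_denominator[OF fin, of c] by blast
  \<comment> \<open>The two remaining coefficients form a family indexed by \<open>bool\<close>, so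
    the same lemma applies to them.\<close>
  obtain d2 b' where d2: "d2 > 0" "\<forall>i\<in>UNIV::bool set. (if i then a0 else a1) * of_int d2 = of_int (b' i)"
    using ex_common_denominator[of "UNIV :: bool set" "\<lambda>i. if i then a0 else a1"] by auto
  define D where "D = d1 * d2"
  have D: "D > 0" using d1 d2 by (simp add: D_def)
  have c: "c l * of_int D = of_int (b l * d2)" if "l \<in> L" for l
    using d1(2) that by (simp add: D_def mult.assoc[symmetric])
  have a0: "a0 * of_int D = of_int (b' True * d1)" and a1: "a1 * of_int D = of_int (b' False * d1)"
    using d2(2) by (auto simp: D_def UNIV_bool algebra_simps)
  have real: "of_rat x * of_int D = (of_int z :: real)" if "x * of_int D = of_int z" for x z
    using arg_cong[OF that, of "of_rat :: rat \<Rightarrow> real"] by (simp add: of_rat_mult)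
  have "(of_rat a0 + of_rat a1 * exp 1 + (\<Sum>l\<in>L. of_rat (c l) * S l)) * of_int D = 0"
    using rel by simp
  also have "(of_rat a0 + of_rat a1 * exp 1 + (\<Sum>l\<in>L. of_rat (c l) * S l)) * of_int D =
    of_rat a0 * of_int D + (of_rat a1 * of_int D) * exp 1 + (\<Sum>l\<in>L. (of_rat (c l) * of_int D) * S l)"
    by (simp add: algebra_simps sum_distrib_left sum_distrib_right)
  also have "\<dots> = of_int (b' True * d1) + of_int (b' False * d1) * exp 1 + (\<Sum>l\<in>L. of_int (b l * d2) * S l)"
    using real[OF a0] real[OF a1] real[OF c] by (simp cong: sum.cong)
  finally have "b' True * d1 = 0 \<and> b' False * d1 = 0 \<and> (\<forall>l\<in>L. b l * d2 = 0)"
    using S_int_relation_trivial[OF fin L, of "b' True * d1" "b' False * d1" "\<lambda>l. b l * d2"] by blast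
  then show ?thesis using a0 a1 c D by auto
qed

text \<open>Independence of a set does not detect coincidences within the family; the further
  conjuncts say that 1, e and the values of \<open>S\<close> on \<open>A\<close> are pairwise
  distinct.\<close>

theorem theorem1:
  fixes A :: "real set"
  defines "A \<equiv> {l. l > 0 \<and> l \<notin> \<int>}"
  shows "rat_real.independent ({1, exp 1} \<union> S ` A) \<and>
         exp 1 \<noteq> (1::real) \<and> inj_on S A \<and> S ` A \<inter> {1, exp 1} = {}"
proof (intro conjI)
  have A: "l \<in> A \<Longrightarrow> l > 0 \<and> l \<notin> \<int>" for l by (simp add: A_def)
  show e: "exp 1 \<noteq> (1::real)" by simp
  show inj: "inj_on S A"
  proof (rule inj_onI, rule ccontr)
    fix x y assume xy: "x \<in> A" "y \<in> A" "S x = S y" "x \<noteq> y"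
    then have "l > 0 \<and> l \<notin> \<int>" if "l \<in> {x, y}" for l
      using A that by auto
    \<comment> \<open>Equal values would give the nontrivial relation S x - S y = 0.\<close>
    from S_rat_relation_trivial[of "{x, y}" 0 0 "\<lambda>l. if l = x then 1 else -1", OF _ this] xy(3,4)
    have "(\<forall>l\<in>{x, y}. (if l = x then 1 else -1) = (0::rat))"
      by (simp add: of_rat_minus)
    then show False by simp
  qed
  show disj: "S ` A \<inter> {1, exp 1} = {}"
  proof -
    have "S l \<noteq> 1" "S l \<noteq> exp 1" if "l \<in> A" for l
      using S_rat_relation_trivial[of "{l}" "-1" 0 "\<lambda>_. 1"] S_rat_relation_trivial[of "{l}" 0 "-1" "\<lambda>_. 1"] A[OF that]
      by (simp_all add: of_rat_minus) blast+
    then show ?thesis by blast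
  qed
  show "rat_real.independent ({1, exp 1} \<union> S ` A)"
    unfolding rat_real.independent_explicit_finite_subsets
  proof (intro allI impI)
    fix T u
    assume T: "T \<subseteq> {1, exp 1} \<union> S ` A" "finite T" and rel: "(\<Sum>v\<in>T. of_rat (u v) * v) = 0"
    \<comment> \<open>T may omit 1 or e; extending the coefficients by 0 brings the relation into
      the form with both present.\<close>
    define w where "w v = (if v \<in> T then u v else 0)" for v
    define L where "L = {l \<in> A. S l \<in> T}"
    have L: "l > 0 \<and> l \<notin> \<int>" if "l \<in> L" for l
      using that A by (simp add: L_def)
    have inj': "inj_on S L" using inj by (rule inj_on_subset) (auto simp: L_def)
    have fin: "finite L"
      using inj' _ T(2) by (rule inj_on_finite) (auto simp: L_def)
    have "(\<Sum>v\<in>T. of_rat (u v) * v) = (\<Sum>v\<in>{1, exp 1} \<union> S ` L. of_rat (w v) * v)"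
      using T fin by (intro sum.mono_neutral_cong_left) (auto simp: w_def L_def)
    also have "\<dots> = (\<Sum>v\<in>{1, exp 1}. of_rat (w v) * v) + (\<Sum>v\<in>S ` L. of_rat (w v) * v)"
      using fin disj by (intro sum.union_disjoint) (auto simp: L_def)
    also have "\<dots> = of_rat (w 1) + of_rat (w (exp 1)) * exp 1 + (\<Sum>l\<in>L. of_rat (w (S l)) * S l)"
      using inj' e by (simp add: sum.reindex)
    finally have "w 1 = 0 \<and> w (exp 1) = 0 \<and> (\<forall>l\<in>L. w (S l) = 0)"
      using S_rat_relation_trivial[OF fin L, of "w 1" "w (exp 1)" "\<lambda>l. w (S l)"] rel by simp
    then have "w v = 0" if "v \<in> T" for v
      using T(1) that by (auto simp: L_def)
    then show "\<forall>v\<in>T. u v = 0" by (simp add: w_def)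
  qed
qed

end
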